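(* Let $B$ be a real Banach space with dual $B^*$ and let $C$ be a nonempty, closed, and convex subset of $B$. For any $x\in B$, if there exists $jx\in J(x)$ such that $\pi_C(jx)\neq\emptyset$, then $\Pi_C(x)$ is a union of nonempty, closed, convex, and bounded subsets of $C$, and $\Pi_C(x)$ is also bounded.
   Context: $\langle\cdot,\cdot\rangle$ is the pairing between $B^*$ and $B$. The normalized duality map is $J(x)=\{\psi\in B^*:\langle\psi,x\rangle=\|\psi\|\|x\|=\|x\|^2=\|\psi\|^2\}$ for $x\in B$. $V(\phi,x)=\|\phi\|^2-2\langle\phi,x\rangle+\|x\|^2$ for $\phi\in B^*$, $x\in B$. The generalized projection is $\pi_C(\phi)=\{u\in C: V(\phi,u)=\inf_{y\in C}V(\phi,y)\}$ for $\phi\in B^*$ (possibly empty), and the generalized metric projection $\Pi_C:B\to 2^C$ is $\Pi_C(x)=\bigcup_{jx\in J(x)}\pi_C(jx)$. *)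

theory Defs
  imports "HOL-Analysis.Analysis"
begin

type_synonym 'a dual = "'a \<Rightarrow>\<^sub>L real"

definition duality_map :: "'a::real_normed_vector \<Rightarrow> 'a dual set" where
  "duality_map x = {\<psi>. blinfun_apply \<psi> x = norm \<psi> * norm x \<and>
      norm \<psi> * norm x = (norm x)\<^sup>2 \<and> (norm x)\<^sup>2 = (norm \<psi>)\<^sup>2}"

definition lyapunov_V :: "'a::real_normed_vector dual \<Rightarrow> 'a \<Rightarrow> real" where
  "lyapunov_V \<phi> x = (norm \<phi>)\<^sup>2 - 2 * blinfun_apply \<phi> x + (norm x)\<^sup>2"

(* The infimum is an infimum of reals; it is meaningful for nonempty C because
   lyapunov_V is bounded below by 0. *)
definition gen_proj :: "'a::real_normed_vector set \<Rightarrow> 'a dual \<Rightarrow> 'a set" where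
  "gen_proj C \<phi> = {u \<in> C. lyapunov_V \<phi> u = (INF y\<in>C. lyapunov_V \<phi> y)}"

definition gen_metric_proj :: "'a::real_normed_vector set \<Rightarrow> 'a \<Rightarrow> 'a set" where
  "gen_metric_proj C x = (\<Union>j\<in>duality_map x. gen_proj C j)"

(* Every set is a union of singletons, so the bare existence of a decomposition into
   nonempty closed convex bounded sets says nothing.  The pieces meant are the nonempty
   sets gen_proj C j, where j ranges over the duality map at x. *)
definition gen_metric_proj_pieces :: "'a::real_normed_vector set \<Rightarrow> 'a \<Rightarrow> 'a set set" where
  "gen_metric_proj_pieces C x = {gen_proj C j | j. j \<in> duality_map x \<and> gen_proj C j \<noteq> {}}"

end

theory Submission
  imports Defs
begin

text \<open>For \<open>j \<in> J(x)\<close> the function \<open>V(j, \<cdot>)\<close> is continuous and convex, and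
  \<open>(\<parallel>j\<parallel> - \<parallel>u\<parallel>)\<^sup>2 \<le> V(j, u) \<le> (\<parallel>j\<parallel> + \<parallel>u\<parallel>)\<^sup>2\<close>. Hence \<open>\<pi>\<^sub>C(j)\<close>, a sublevel set
  of \<open>V(j, \<cdot>)\<close> in \<open>C\<close>, is closed and convex. The norm bound on its elements depends only on
  \<open>\<parallel>j\<parallel> = \<parallel>x\<parallel>\<close> and on one fixed point of \<open>C\<close>, so it is uniform over \<open>j \<in> J(x)\<close>.\<close>

lemma norm_duality_map: "j \<in> duality_map x \<Longrightarrow> norm j = norm x"
  by (simp add: duality_map_def)

lemma lyapunov_V_ge: "(norm \<phi> - norm u)\<^sup>2 \<le> lyapunov_V \<phi> u"
  using norm_blinfun[of \<phi> u] by (simp add: lyapunov_V_def power2_diff mult.commute)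

lemma lyapunov_V_le: "lyapunov_V \<phi> u \<le> (norm \<phi> + norm u)\<^sup>2"
  using norm_blinfun[of \<phi> u] by (simp add: lyapunov_V_def power2_sum abs_le_iff mult.commute)

text \<open>Real infima are only conditionally complete; this licenses \<open>cINF_lower\<close>
  below.\<close>

lemma bdd_below_lyapunov_V: "bdd_below (lyapunov_V \<phi> ` C)"
  by (rule bdd_belowI2[of _ 0]) (meson lyapunov_V_ge order_trans zero_le_power2)

text \<open>On \<open>C\<close> the infimum is a lower bound, so attaining it means not exceeding
  it. The inequality form lets closedness and convexity pass to the intersection.\<close>

lemma gen_proj_eq_sublevel:
  "gen_proj C \<phi> = C \<inter> {u. lyapunov_V \<phi> u \<le> (INF y\<in>C. lyapunov_V \<phi> y)}"
  using cINF_lower[OF bdd_below_lyapunov_V] unfolding gen_proj_def by (auto intro: antisym)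

text \<open>Apart from the squared norm, \<open>lyapunov_V \<phi>\<close> is affine, so only the
  squared norm needs an argument.\<close>

lemma convex_on_lyapunov_V: "convex_on UNIV (lyapunov_V \<phi>)"
proof (rule convex_onI)
  fix t :: real and x y :: 'a
  assume t: "0 < t" "t < 1"
  have "norm ((1 - t) *\<^sub>R x + t *\<^sub>R y) \<le> (1 - t) * norm x + t * norm y"
    using t by (metis norm_triangle_ineq norm_scaleR abs_of_pos diff_gt_0_iff_gt)
  then have "(norm ((1 - t) *\<^sub>R x + t *\<^sub>R y))\<^sup>2 \<le> ((1 - t) * norm x + t * norm y)\<^sup>2"
    by (simp add: power_mono)
  \<comment> \<open>Exact convexity gap of the real square; the subtracted term is
    nonnegative.\<close>
  also have "\<dots> = (1 - t) * (norm x)\<^sup>2 + t * (norm y)\<^sup>2 - t * (1 - t) * (norm x - norm y)\<^sup>2"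
    by (simp add: power2_eq_square algebra_simps)
  also have "\<dots> \<le> (1 - t) * (norm x)\<^sup>2 + t * (norm y)\<^sup>2"
    using t by simp
  finally show "lyapunov_V \<phi> ((1 - t) *\<^sub>R x + t *\<^sub>R y)
      \<le> (1 - t) * lyapunov_V \<phi> x + t * lyapunov_V \<phi> y"
    by (simp add: lyapunov_V_def blinfun.add_right blinfun.diff_right blinfun.scaleR_right
        algebra_simps)
qed simp

lemma convex_Collect_lyapunov_V_le: "convex {u. lyapunov_V \<phi> u \<le> c}"
  unfolding convex_alt
proof (intro ballI allI impI, clarsimp)
  fix x y and t :: real
  assume le: "lyapunov_V \<phi> x \<le> c" "lyapunov_V \<phi> y \<le> c" and t: "0 \<le> t" "t \<le> 1"
  have "lyapunov_V \<phi> ((1 - t) *\<^sub>R x + t *\<^sub>R y)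
      \<le> (1 - t) * lyapunov_V \<phi> x + t * lyapunov_V \<phi> y"
    using convex_onD[OF convex_on_lyapunov_V t] by simp
  also have "\<dots> \<le> c"
    using le t by (intro convex_bound_le) auto
  finally show "lyapunov_V \<phi> ((1 - t) *\<^sub>R x + t *\<^sub>R y) \<le> c" .
qed

lemma convex_gen_proj: "convex C \<Longrightarrow> convex (gen_proj C \<phi>)"
  unfolding gen_proj_eq_sublevel
  by (intro convex_Int convex_Collect_lyapunov_V_le)

lemma closed_gen_proj: "closed C \<Longrightarrow> closed (gen_proj C \<phi>)"
  unfolding gen_proj_eq_sublevel lyapunov_V_def
  by (intro closed_Int closed_Collect_le continuous_intros)

text \<open>Comparing a minimizer with a competitor \<open>y\<close> puts both values between two
  squares; taking roots gives the bound.\<close>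

lemma norm_le_of_mem_gen_proj:
  assumes "u \<in> gen_proj C \<phi>" and "y \<in> C"
  shows "norm u \<le> 2 * norm \<phi> + norm y"
proof -
  have "lyapunov_V \<phi> u \<le> lyapunov_V \<phi> y"
    using assms cINF_lower[OF bdd_below_lyapunov_V] by (auto simp: gen_proj_def)
  then have "(norm \<phi> - norm u)\<^sup>2 \<le> (norm \<phi> + norm y)\<^sup>2"
    using lyapunov_V_ge lyapunov_V_le by (meson order_trans)
  then have "\<bar>norm \<phi> - norm u\<bar> \<le> norm \<phi> + norm y"
    by (simp add: abs_le_square_iff[symmetric])
  then show ?thesis by linarith
qed

lemma bounded_gen_metric_proj: "bounded (gen_metric_proj C x)"
proof (cases "C = {}")
  case False
  \<comment> \<open>One \<open>y\<close> serves every \<open>j\<close> in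
    \<open>duality_map x\<close>, giving the common bound
    \<open>2 * norm x + norm y\<close>.\<close>
  then obtain y where "y \<in> C" by blast
  then show ?thesis
    unfolding bounded_iff gen_metric_proj_def
    by (metis UN_E norm_duality_map norm_le_of_mem_gen_proj)
qed (simp add: gen_metric_proj_def gen_proj_def)

theorem theorem3p5:
  fixes C :: "'a::banach set" and x :: 'a
  assumes "C \<noteq> {}" and "closed C" and "convex C"
    and "\<exists>j\<in>duality_map x. gen_proj C j \<noteq> {}"
  shows "gen_metric_proj_pieces C x \<noteq> {} \<and>
    gen_metric_proj C x = \<Union> (gen_metric_proj_pieces C x) \<and>
    (\<forall>S\<in>gen_metric_proj_pieces C x.
       S \<noteq> {} \<and> closed S \<and> convex S \<and> bounded S \<and> S \<subseteq> C) \<and>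
    bounded (gen_metric_proj C x)"
proof (intro conjI ballI)
  show union: "gen_metric_proj C x = \<Union> (gen_metric_proj_pieces C x)"
    by (auto simp: gen_metric_proj_def gen_metric_proj_pieces_def)
  show "gen_metric_proj_pieces C x \<noteq> {}"
    using assms(4) by (auto simp: gen_metric_proj_pieces_def)
  fix S assume S: "S \<in> gen_metric_proj_pieces C x"
  then obtain j where j: "S = gen_proj C j" "S \<noteq> {}"
    by (auto simp: gen_metric_proj_pieces_def)
  show "S \<noteq> {}" by fact
  show "closed S" using j assms(2) closed_gen_proj by blast
  show "convex S" using j assms(3) convex_gen_proj by blast
  \<comment> \<open>Each piece inherits boundedness from the whole union.\<close>
  show "bounded S" using S union bounded_gen_metric_proj bounded_subset by (metis Sup_upper)
  show "S \<subseteq> C" using j by (auto simp: gen_proj_def)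
qed (rule bounded_gen_metric_proj)

end
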